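(* Let $\mathcal A=\{0,1\}$, let $\hat\mu:\mathcal A\times\mathcal X\to\mathbb R$ be an outcome model (an estimate of $\mathbb E[Y\mid X=x,A=a]$, regarded as a fixed function), and let $$\widehat{\mathrm{ATE}}_{\mathrm{DR}}=\frac1n\sum_{i=1}^n\rho_{\mathrm{ATE}}(a_i,x_i)\,(y_i-\hat\mu(a_i,x_i))+\frac1n\sum_{i=1}^n\big(\hat\mu(1,x_i)-\hat\mu(0,x_i)\big),\qquad \widehat{\mathrm{ATE}}_{\mathrm{MR}}=\frac1n\sum_{i=1}^n w_{\mathrm{ATE}}(y_i)\,y_i,$$ where $$\rho_{\mathrm{ATE}}(a,x)=\frac{\mathbb 1(a=1)-\mathbb 1(a=0)}{\pi^b(a\mid x)},\qquad w_{\mathrm{ATE}}(y)=\frac{p_{\pi^{(1)}}(y)-p_{\pi^{(0)}}(y)}{p_{\pi^b}(y)} .$$ When the weights $\rho_{\mathrm{ATE}}(a,x)$ and $w_{\mathrm{ATE}}(y)$ are known exactly, $$\mathrm{Var}[\widehat{\mathrm{ATE}}_{\mathrm{DR}}]-\mathrm{Var}[\widehat{\mathrm{ATE}}_{\mathrm{MR}}]\ge\frac1n\,\mathbb E\Big[\mathrm{Var}[\rho_{\mathrm{ATE}}(A,X)\,Y\mid Y]-\mathrm{Var}[\rho_{\mathrm{ATE}}(A,X)\,\mu(A,X)\mid X]\Big],$$ where $\mu(A,X):=\mathbb E[Y\mid X,A]$.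
   Context: $X\in\mathcal X$ is a covariate vector, $A\in\mathcal A=\{0,1\}$ a treatment, $Y\in\mathcal Y\subseteq\mathbb R$ a scalar outcome. For a policy $\pi(a\mid x)$ the joint density of $(X,A,Y)$ is $p_\pi(x,a,y)=p(y\mid x,a)\,\pi(a\mid x)\,p(x)$ (with respect to fixed reference measures), with $Y$-marginal $p_\pi(y)$. $\pi^b$ is the behaviour (treatment assignment) policy and, for $a\in\{0,1\}$, $\pi^{(a)}(a'\mid x)=\mathbb 1(a'=a)$ is the deterministic policy always choosing $a$. The data $(x_i,a_i,y_i)_{i=1}^n$ are i.i.d. from $p_{\pi^b}$, and $\mathbb E,\mathrm{Var}$ (for $(X,A,Y)$ and for the estimators) are under $\pi^b$. Standing assumption (support) for the target policies $\pi^{(0)},\pi^{(1)}$: $\pi^b(a\mid x)>0$ for all $x\in\mathcal X$, $a\in\{0,1\}$. All expectations and variances appearing are implicitly assumed to exist and be finite. *)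

theory Defs
  imports "HOL-Probability.Probability"
begin

text \<open>
  A data point is a triple \<open>(x, a, y)\<close> of covariates, action and outcome.  The covariate space and the
  outcome space are the spaces of the reference measures \<open>MX\<close> and \<open>MY\<close>; the reference measure on the
  action space \<open>{0, 1}\<close> is counting measure.
\<close>

abbreviation actions :: "nat measure" where
  "actions \<equiv> count_space {0, 1}"

abbreviation ref_measure :: "'x measure \<Rightarrow> real measure \<Rightarrow> ('x \<times> nat \<times> real) measure" where
  "ref_measure MX MY \<equiv> MX \<Otimes>\<^sub>M (actions \<Otimes>\<^sub>M MY)"

text \<open>
  \<open>p x\<close> is the covariate density, \<open>q y x a\<close> the conditional outcome density \<open>p(y | x, a)\<close>, and
  \<open>\<pi>b a x\<close> the behaviour policy \<open>\<pi>b(a | x)\<close>.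
\<close>

locale bandit_model =
  MX: sigma_finite_measure MX + MY: sigma_finite_measure MY
  for MX :: "'x measure" and MY :: "real measure" +
  fixes p :: "'x \<Rightarrow> real"
    and q :: "real \<Rightarrow> 'x \<Rightarrow> nat \<Rightarrow> real"
    and \<pi>b :: "nat \<Rightarrow> 'x \<Rightarrow> real"
  assumes sets_MY: "sets MY = sets (restrict_space borel (space MY))"
    and p_measurable: "p \<in> borel_measurable MX"
    and p_nonneg: "\<And>x. x \<in> space MX \<Longrightarrow> 0 \<le> p x"
    and p_normalized: "(\<integral>\<^sup>+ x. ennreal (p x) \<partial>MX) = 1"
    and q_measurable: "(\<lambda>(x, a, y). q y x a) \<in> borel_measurable (ref_measure MX MY)"
    and q_nonneg: "\<And>x a y. x \<in> space MX \<Longrightarrow> a \<in> {0, 1} \<Longrightarrow> y \<in> space MY \<Longrightarrow> 0 \<le> q y x a"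
    and q_normalized:
      "\<And>x a. x \<in> space MX \<Longrightarrow> a \<in> {0, 1} \<Longrightarrow> (\<integral>\<^sup>+ y. ennreal (q y x a) \<partial>MY) = 1"
    and \<pi>b_measurable: "(\<lambda>(a, x). \<pi>b a x) \<in> borel_measurable (actions \<Otimes>\<^sub>M MX)"
    and \<pi>b_normalized: "\<And>x. x \<in> space MX \<Longrightarrow> (\<Sum>a\<in>{0, 1}. \<pi>b a x) = 1"
    and \<pi>b_support: "\<And>x a. x \<in> space MX \<Longrightarrow> a \<in> {0, 1} \<Longrightarrow> 0 < \<pi>b a x"

definition joint_density ::
    "('x \<Rightarrow> real) \<Rightarrow> (real \<Rightarrow> 'x \<Rightarrow> nat \<Rightarrow> real) \<Rightarrow> (nat \<Rightarrow> 'x \<Rightarrow> real) \<Rightarrow> 'x \<times> nat \<times> real \<Rightarrow> real" where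
  "joint_density p q \<pi> = (\<lambda>(x, a, y). q y x a * \<pi> a x * p x)"

definition joint_dist ::
    "'x measure \<Rightarrow> real measure \<Rightarrow> ('x \<Rightarrow> real) \<Rightarrow> (real \<Rightarrow> 'x \<Rightarrow> nat \<Rightarrow> real) \<Rightarrow> (nat \<Rightarrow> 'x \<Rightarrow> real)
      \<Rightarrow> ('x \<times> nat \<times> real) measure" where
  "joint_dist MX MY p q \<pi> = density (ref_measure MX MY) (\<lambda>z. ennreal (joint_density p q \<pi> z))"

definition outcome_density ::
    "'x measure \<Rightarrow> ('x \<Rightarrow> real) \<Rightarrow> (real \<Rightarrow> 'x \<Rightarrow> nat \<Rightarrow> real) \<Rightarrow> (nat \<Rightarrow> 'x \<Rightarrow> real) \<Rightarrow> real \<Rightarrow> real" where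
  "outcome_density MX p q \<pi> y = (\<integral>x. (\<Sum>a\<in>{0, 1}. joint_density p q \<pi> (x, a, y)) \<partial>MX)"

definition det_policy :: "nat \<Rightarrow> nat \<Rightarrow> 'x \<Rightarrow> real" where
  "det_policy a a' x = of_bool (a' = a)"

definition rho_ATE :: "(nat \<Rightarrow> 'x \<Rightarrow> real) \<Rightarrow> nat \<Rightarrow> 'x \<Rightarrow> real" where
  "rho_ATE \<pi>b a x = (of_bool (a = 1) - of_bool (a = 0)) / \<pi>b a x"

definition w_ATE ::
    "'x measure \<Rightarrow> ('x \<Rightarrow> real) \<Rightarrow> (real \<Rightarrow> 'x \<Rightarrow> nat \<Rightarrow> real) \<Rightarrow> (nat \<Rightarrow> 'x \<Rightarrow> real) \<Rightarrow> real \<Rightarrow> real" where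
  "w_ATE MX p q \<pi>b y =
    (outcome_density MX p q (det_policy 1) y - outcome_density MX p q (det_policy 0) y)
      / outcome_density MX p q \<pi>b y"

text \<open>In the estimators, \<open>d i\<close> for \<open>i < n\<close> are the data points.\<close>

definition ATE_DR ::
    "(nat \<Rightarrow> 'x \<Rightarrow> real) \<Rightarrow> (nat \<Rightarrow> 'x \<Rightarrow> real) \<Rightarrow> nat \<Rightarrow> (nat \<Rightarrow> 'x \<times> nat \<times> real) \<Rightarrow> real" where
  "ATE_DR \<pi>b \<mu>hat n d =
    1 / real n * (\<Sum>i<n. case d i of (x, a, y) \<Rightarrow> rho_ATE \<pi>b a x * (y - \<mu>hat a x))
    + 1 / real n * (\<Sum>i<n. case d i of (x, a, y) \<Rightarrow> \<mu>hat 1 x - \<mu>hat 0 x)"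

definition ATE_MR :: "(real \<Rightarrow> real) \<Rightarrow> nat \<Rightarrow> (nat \<Rightarrow> 'x \<times> nat \<times> real) \<Rightarrow> real" where
  "ATE_MR w n d = 1 / real n * (\<Sum>i<n. case d i of (x, a, y) \<Rightarrow> w y * y)"

definition cond_var :: "'a measure \<Rightarrow> 'a measure \<Rightarrow> ('a \<Rightarrow> real) \<Rightarrow> 'a \<Rightarrow> real" where
  "cond_var M F Z = real_cond_exp M F (\<lambda>\<omega>. (Z \<omega> - real_cond_exp M F Z \<omega>)\<^sup>2)"

text \<open>
  Existence of the conditional variance with finite expectation.  It is stated through the squared
  deviation because \<open>real_cond_exp\<close> is a total operator, so integrability of \<open>cond_var\<close>
  itself would not exclude infinite values.
\<close>

definition has_cond_var :: "'a measure \<Rightarrow> 'a measure \<Rightarrow> ('a \<Rightarrow> real) \<Rightarrow> bool" where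
  "has_cond_var M F Z \<longleftrightarrow>
    integrable M Z \<and> integrable M (\<lambda>\<omega>. (Z \<omega> - real_cond_exp M F Z \<omega>)\<^sup>2)"

definition sigma_X :: "'x measure \<Rightarrow> real measure \<Rightarrow> ('x \<times> nat \<times> real) measure" where
  "sigma_X MX MY = vimage_algebra (space (ref_measure MX MY)) (\<lambda>(x, a, y). x) MX"

definition sigma_XA :: "'x measure \<Rightarrow> real measure \<Rightarrow> ('x \<times> nat \<times> real) measure" where
  "sigma_XA MX MY =
    vimage_algebra (space (ref_measure MX MY)) (\<lambda>(x, a, y). (x, a)) (MX \<Otimes>\<^sub>M actions)"

definition sigma_Y :: "'x measure \<Rightarrow> real measure \<Rightarrow> ('x \<times> nat \<times> real) measure" where
  "sigma_Y MX MY = vimage_algebra (space (ref_measure MX MY)) (\<lambda>(x, a, y). y) MY"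

text \<open>The random variables \<open>\<rho>(A, X) Y\<close> and \<open>\<rho>(A, X) \<mu>(A, X)\<close>, where \<open>\<mu>(A, X) = E[Y | X, A]\<close> under \<open>P\<close>.\<close>

definition rho_Y :: "(nat \<Rightarrow> 'x \<Rightarrow> real) \<Rightarrow> 'x \<times> nat \<times> real \<Rightarrow> real" where
  "rho_Y \<pi>b = (\<lambda>(x, a, y). rho_ATE \<pi>b a x * y)"

definition mu_XA ::
    "'x measure \<Rightarrow> real measure \<Rightarrow> ('x \<times> nat \<times> real) measure \<Rightarrow> 'x \<times> nat \<times> real \<Rightarrow> real" where
  "mu_XA MX MY P = real_cond_exp P (sigma_XA MX MY) (\<lambda>(x, a, y). y)"

definition rho_mu ::
    "'x measure \<Rightarrow> real measure \<Rightarrow> ('x \<times> nat \<times> real) measure \<Rightarrow> (nat \<Rightarrow> 'x \<Rightarrow> real)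
      \<Rightarrow> 'x \<times> nat \<times> real \<Rightarrow> real" where
  "rho_mu MX MY P \<pi>b = (\<lambda>(x, a, y). rho_ATE \<pi>b a x * mu_XA MX MY P (x, a, y))"

end

theory Submission
  imports Defs
begin

text \<open>
  With \<open>m(x) = \<pi>b(0|x) \<mu>hat(1,x) + \<pi>b(1|x) \<mu>hat(0,x)\<close>, a single DR term equals
  \<open>\<rho> Y - \<rho> m(X)\<close>, and \<open>E[\<rho> m(X) | X] = 0\<close>.  (\<open>\<mu>hat\<close> itself need not be integrable, so the term is
  never split into its \<open>\<mu>hat\<close>-summands.)  Conditioning \<open>\<rho> Y\<close> and the DR term on \<open>(X, A)\<close> leaves the same
  residual \<open>\<rho> (Y - \<mu>)\<close>, and conditioning the remainder \<open>\<rho> \<mu> - \<rho> m\<close> on \<open>X\<close> gives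
  \<open>Var(\<rho> \<mu> - \<rho> m) \<ge> Var(E[\<rho> \<mu> | X]) = Var(\<rho> \<mu>) - E Var[\<rho> \<mu> | X]\<close>.  Hence the DR term has variance at least
  \<open>Var(\<rho> Y) - E Var[\<rho> \<mu> | X]\<close>, while \<open>w(Y) Y = E[\<rho> Y | Y]\<close> gives
  \<open>Var(\<rho> Y) = Var(w(Y) Y) + E Var[\<rho> Y | Y]\<close>.
\<close>

section \<open>Square integrability and variances of sums of independent variables\<close>

lemma integrable_times_of_squares:
  fixes f g :: "'a \<Rightarrow> real"
  assumes [measurable]: "f \<in> borel_measurable M" "g \<in> borel_measurable M"
    and "integrable M (\<lambda>x. (f x)\<^sup>2)" "integrable M (\<lambda>x. (g x)\<^sup>2)"
  shows "integrable M (\<lambda>x. f x * g x)"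
proof (rule Bochner_Integration.integrable_bound)
  show "integrable M (\<lambda>x. (f x)\<^sup>2 + (g x)\<^sup>2)" using assms(3,4) by simp
  have "\<bar>a * b\<bar> \<le> a\<^sup>2 + b\<^sup>2" for a b :: real
  proof -
    have "0 \<le> \<bar>a\<bar> * \<bar>b\<bar>" by simp
    with sum_squares_bound[of "\<bar>a\<bar>" "\<bar>b\<bar>"] show ?thesis
      by (simp only: abs_mult power2_abs mult.assoc)
  qed
  then show "AE x in M. norm (f x * g x) \<le> norm ((f x)\<^sup>2 + (g x)\<^sup>2)" by simp
qed simp

lemma integrable_square_add:
  fixes f g :: "'a \<Rightarrow> real"
  assumes [measurable]: "f \<in> borel_measurable M" "g \<in> borel_measurable M"
    and "integrable M (\<lambda>x. (f x)\<^sup>2)" "integrable M (\<lambda>x. (g x)\<^sup>2)"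
  shows "integrable M (\<lambda>x. (f x + g x)\<^sup>2)"
  using assms(3,4) integrable_times_of_squares[OF assms]
  by (simp add: power2_sum mult.assoc)

lemma integrable_square_sum:
  fixes f :: "'i \<Rightarrow> 'a \<Rightarrow> real"
  assumes "finite I"
    and "\<And>i. i \<in> I \<Longrightarrow> f i \<in> borel_measurable M"
    and "\<And>i. i \<in> I \<Longrightarrow> integrable M (\<lambda>x. (f i x)\<^sup>2)"
  shows "integrable M (\<lambda>x. (\<Sum>i\<in>I. f i x)\<^sup>2)"
  using assms by (induction I) (auto intro!: integrable_square_add borel_measurable_sum)

text \<open>Extended nonnegative values are used because this is applied to the square of
  \<open>X\<close> below, whose integrability is exactly what is to be shown.\<close>

lemma (in prob_space) indep_var_nn_integral_mult:
  assumes "indep_var borel X borel Y"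
  shows "(\<integral>\<^sup>+\<omega>. X \<omega> * Y \<omega> \<partial>M) = (\<integral>\<^sup>+\<omega>. X \<omega> \<partial>M) * (\<integral>\<^sup>+\<omega>. Y \<omega> \<partial>M)"
proof -
  \<comment> \<open>\<open>indep_var\<close> is independence of a family indexed by
    \<open>bool\<close>; the product formula for families expects a constant target measure.\<close>
  have "(\<lambda>_. borel) = case_bool borel (borel :: ennreal measure)"
    by (auto split: bool.split)
  then have "indep_vars (\<lambda>_. borel) (case_bool X Y) UNIV"
    using assms by (simp add: indep_var_def)
  from indep_vars_nn_integral[OF _ this] show ?thesis
    by (simp add: UNIV_bool mult.commute)
qed

text \<open>On the event \<open>\<bar>Y\<bar> \<le> c\<close>, which is independent of \<open>X\<close> and has positive probability for some
  \<open>c\<close>, \<open>X\<^sup>2\<close> is dominated by \<open>2 (X + Y)\<^sup>2 + 2 c\<^sup>2\<close>.\<close>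
lemma (in prob_space) indep_var_square_integrable_summand:
  fixes X Y :: "'a \<Rightarrow> real"
  assumes indep: "indep_var borel X borel Y"
    and sq: "integrable M (\<lambda>\<omega>. (X \<omega> + Y \<omega>)\<^sup>2)"
  shows "integrable M (\<lambda>\<omega>. (X \<omega>)\<^sup>2)"
proof -
  have [measurable]: "random_variable borel X" "random_variable borel Y"
    using indep_var_rv1[OF indep] indep_var_rv2[OF indep] by auto
  define E where "E c = {\<omega> \<in> space M. \<bar>Y \<omega>\<bar> \<le> real c}" for c :: nat
  have E_sets [measurable]: "E c \<in> events" for c unfolding E_def by measurable
  \<comment> \<open>Since \<open>Y\<close> is real-valued, the events \<open>E c\<close> exhaust the
    space and cannot all be null.\<close>
  have "(\<Union>c. E c) = space M"
    unfolding E_def using real_arch_simple by auto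
  then have "\<exists>c. emeasure M (E c) \<noteq> 0"
    using emeasure_UN_eq_0[of M E] E_sets by (auto simp: emeasure_space_1 image_subset_iff)
  then obtain c where c: "emeasure M (E c) \<noteq> 0" by blast
  have "indep_var borel ((\<lambda>x. ennreal (x\<^sup>2)) \<circ> X) borel ((\<lambda>y. indicator {- real c..real c} y) \<circ> Y)"
    by (rule indep_var_compose[OF indep]) auto
  then have "(\<integral>\<^sup>+\<omega>. ennreal ((X \<omega>)\<^sup>2) * indicator {- real c..real c} (Y \<omega>) \<partial>M)
      = (\<integral>\<^sup>+\<omega>. ennreal ((X \<omega>)\<^sup>2) \<partial>M) * (\<integral>\<^sup>+\<omega>. indicator {- real c..real c} (Y \<omega>) \<partial>M)"
    using indep_var_nn_integral_mult by (simp add: comp_def)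
  also have "(\<integral>\<^sup>+\<omega>. indicator {- real c..real c} (Y \<omega>) \<partial>M) = (\<integral>\<^sup>+\<omega>. indicator (E c) \<omega> \<partial>M)"
    by (rule nn_integral_cong) (auto simp: E_def indicator_def)
  also have "\<dots> = emeasure M (E c)" by simp
  finally have prod: "(\<integral>\<^sup>+\<omega>. ennreal ((X \<omega>)\<^sup>2) * indicator {- real c..real c} (Y \<omega>) \<partial>M)
      = (\<integral>\<^sup>+\<omega>. ennreal ((X \<omega>)\<^sup>2) \<partial>M) * emeasure M (E c)" .
  have bound: "x\<^sup>2 \<le> 2 * (x + y)\<^sup>2 + 2 * (real c)\<^sup>2" if "\<bar>y\<bar> \<le> real c" for x y
  proof -
    have "y\<^sup>2 \<le> (real c)\<^sup>2" using that by (simp add: abs_le_square_iff[symmetric])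
    \<comment> \<open>The difference \<open>2 * (x + y)\<^sup>2 + 2 * y\<^sup>2 - x\<^sup>2\<close>
      is exactly this square.\<close>
    moreover have "0 \<le> (x + 2 * y)\<^sup>2" by simp
    ultimately show ?thesis by (simp add: power2_eq_square algebra_simps)
  qed
  have "(\<integral>\<^sup>+\<omega>. ennreal ((X \<omega>)\<^sup>2) * indicator {- real c..real c} (Y \<omega>) \<partial>M)
      \<le> (\<integral>\<^sup>+\<omega>. ennreal (2 * (X \<omega> + Y \<omega>)\<^sup>2 + 2 * (real c)\<^sup>2) \<partial>M)"
    by (rule nn_integral_mono) (auto simp: indicator_def simp del: ennreal_plus intro!: ennreal_leI bound)
  also have "\<dots> = ennreal (\<integral>\<omega>. 2 * (X \<omega> + Y \<omega>)\<^sup>2 + 2 * (real c)\<^sup>2 \<partial>M)"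
    using sq by (intro nn_integral_eq_integral) auto
  also have "\<dots> < \<infinity>" by simp
  \<comment> \<open>The product is finite and its second factor is nonzero, so the first factor
    cannot be infinite.\<close>
  finally have "(\<integral>\<^sup>+\<omega>. ennreal ((X \<omega>)\<^sup>2) \<partial>M) < \<infinity>"
    using c unfolding prod by (auto simp: ennreal_mult_less_top)
  then show ?thesis by (intro integrableI_bounded) auto
qed

text \<open>The sum of the remaining terms is independent of the chosen one, so the two-variable
  case applies. This passes finite variance of an estimator down to a single observation.\<close>

lemma (in prob_space) indep_vars_square_integrable_summand:
  fixes X :: "'i \<Rightarrow> 'a \<Rightarrow> real"
  assumes "finite I" "indep_vars (\<lambda>_. borel) X I" "i \<in> I"
    and sq: "integrable M (\<lambda>\<omega>. (\<Sum>i\<in>I. X i \<omega>)\<^sup>2)"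
  shows "integrable M (\<lambda>\<omega>. (X i \<omega>)\<^sup>2)"
proof (rule indep_var_square_integrable_summand)
  show "indep_var borel (X i) borel (\<lambda>\<omega>. \<Sum>j\<in>I - {i}. X j \<omega>)"
    using assms by (intro indep_vars_sum) (auto simp: insert_absorb)
  show "integrable M (\<lambda>\<omega>. (X i \<omega> + (\<Sum>j\<in>I - {i}. X j \<omega>))\<^sup>2)"
    using sq by (simp add: sum.remove[OF assms(1,3)])
qed

text \<open>Independence factorises \<open>E[X Y]\<close>, so the mixed terms of the second moment
  and of the squared mean cancel.\<close>

lemma (in prob_space) variance_indep_add:
  fixes X Y :: "'a \<Rightarrow> real"
  assumes indep: "indep_var borel X borel Y"
    and X: "integrable M (\<lambda>\<omega>. (X \<omega>)\<^sup>2)" and Y: "integrable M (\<lambda>\<omega>. (Y \<omega>)\<^sup>2)"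
  shows "variance (\<lambda>\<omega>. X \<omega> + Y \<omega>) = variance X + variance Y"
proof -
  have [measurable]: "random_variable borel X" "random_variable borel Y"
    using indep_var_rv1[OF indep] indep_var_rv2[OF indep] by auto
  have int: "integrable M X" "integrable M Y"
    using X Y by (auto intro: square_integrable_imp_integrable)
  have XY: "integrable M (\<lambda>\<omega>. X \<omega> * Y \<omega>)"
    "expectation (\<lambda>\<omega>. X \<omega> * Y \<omega>) = expectation X * expectation Y"
    using indep_var_integrable[OF indep int] indep_var_lebesgue_integral[OF indep int] by auto
  have "expectation (\<lambda>\<omega>. (X \<omega> + Y \<omega>)\<^sup>2)
      = expectation (\<lambda>\<omega>. (X \<omega>)\<^sup>2) + expectation (\<lambda>\<omega>. (Y \<omega>)\<^sup>2) + 2 * (expectation X * expectation Y)"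
    using X Y XY by (simp add: power2_sum mult.assoc)
  moreover have "variance (\<lambda>\<omega>. X \<omega> + Y \<omega>)
      = expectation (\<lambda>\<omega>. (X \<omega> + Y \<omega>)\<^sup>2) - (expectation (\<lambda>\<omega>. X \<omega> + Y \<omega>))\<^sup>2"
    using int integrable_square_add[OF _ _ X Y] by (intro variance_eq) auto
  moreover have "expectation (\<lambda>\<omega>. X \<omega> + Y \<omega>) = expectation X + expectation Y"
    using int by simp
  ultimately show ?thesis
    using variance_eq[OF int(1) X] variance_eq[OF int(2) Y] by (simp only: power2_sum)
qed

lemma (in prob_space) variance_indep_sum:
  fixes X :: "'i \<Rightarrow> 'a \<Rightarrow> real"
  assumes "finite I" "indep_vars (\<lambda>_. borel) X I"
    and "\<And>i. i \<in> I \<Longrightarrow> integrable M (\<lambda>\<omega>. (X i \<omega>)\<^sup>2)"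
  shows "variance (\<lambda>\<omega>. \<Sum>i\<in>I. X i \<omega>) = (\<Sum>i\<in>I. variance (X i))"
  using assms
proof (induction I)
  case (insert i I)
  have indep: "indep_vars (\<lambda>_. borel) X I"
    using insert.prems(1) by (rule indep_vars_subset) auto
  have "integrable M (\<lambda>\<omega>. (\<Sum>i\<in>I. X i \<omega>)\<^sup>2)"
    using insert.hyps(1) insert.prems(2) indep
    by (intro integrable_square_sum) (auto simp: indep_vars_def)
  then have "variance (\<lambda>\<omega>. X i \<omega> + (\<Sum>j\<in>I. X j \<omega>)) = variance (X i) + variance (\<lambda>\<omega>. \<Sum>j\<in>I. X j \<omega>)"
    using insert.hyps insert.prems by (intro variance_indep_add indep_vars_sum) auto
  then show ?case using insert indep by simp
qed simp

text \<open>Reduces an estimator to one observation under \<open>P\<close>. Square integrability is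
  assumed of the mean only; independence transfers it to the summands, and then variances add
  up.\<close>

lemma (in prob_space) iid_mean_square_integrable_and_variance:
  fixes f :: "'b \<Rightarrow> real"
  assumes n: "1 \<le> n"
    and indep: "indep_vars (\<lambda>_. N) D {..<n}"
    and ident: "\<And>i. i < n \<Longrightarrow> distr M N (D i) = P"
    and f: "f \<in> borel_measurable N"
    and sq: "integrable M (\<lambda>\<omega>. (1 / real n * (\<Sum>i<n. f (D i \<omega>)))\<^sup>2)"
  shows "integrable P (\<lambda>z. (f z)\<^sup>2)"
    and "variance (\<lambda>\<omega>. 1 / real n * (\<Sum>i<n. f (D i \<omega>)))
      = 1 / real n * (\<integral>z. (f z - (\<integral>z. f z \<partial>P))\<^sup>2 \<partial>P)"
proof -
  note f [measurable]
  have D [measurable]: "D i \<in> measurable M N" if "i < n" for i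
    using indep that by (auto simp: indep_vars_def)
  \<comment> \<open>\<open>P\<close> is tied to the sample through an existing index, which
    \<open>1 \<le> n\<close> provides.\<close>
  have P: "P = distr M N (D 0)" using ident[of 0] n by simp
  have fD: "indep_vars (\<lambda>_. borel) (\<lambda>i \<omega>. f (D i \<omega>)) {..<n}"
    by (rule indep_vars_compose2[OF indep]) simp
  have "(\<Sum>i<n. f (D i \<omega>))\<^sup>2 = (real n)\<^sup>2 * (1 / real n * (\<Sum>i<n. f (D i \<omega>)))\<^sup>2" for \<omega>
    using n by (simp add: power_divide)
  then have "integrable M (\<lambda>\<omega>. (\<Sum>i<n. f (D i \<omega>))\<^sup>2)"
    using integrable_mult_right[OF sq, of "(real n)\<^sup>2"] by simp
  then have sqi: "integrable M (\<lambda>\<omega>. (f (D i \<omega>))\<^sup>2)" if "i < n" for i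
    using indep_vars_square_integrable_summand[OF _ fD, of i] that by simp
  show "integrable P (\<lambda>z. (f z)\<^sup>2)"
    using sqi[of 0] n D[of 0] by (simp add: P integrable_distr_eq)
  have var: "variance (\<lambda>\<omega>. f (D i \<omega>)) = (\<integral>z. (f z - (\<integral>z. f z \<partial>P))\<^sup>2 \<partial>P)" if "i < n" for i
    using D[OF that] by (simp add: ident[OF that, symmetric] integral_distr)
  have "variance (\<lambda>\<omega>. \<Sum>i<n. f (D i \<omega>)) = real n * (\<integral>z. (f z - (\<integral>z. f z \<partial>P))\<^sup>2 \<partial>P)"
    using variance_indep_sum[OF _ fD] sqi var by simp
  moreover have "variance (\<lambda>\<omega>. 1 / real n * X \<omega>) = (1 / real n)\<^sup>2 * variance X" for X
  proof -
    have "(1 / real n * X \<omega> - expectation (\<lambda>\<omega>. 1 / real n * X \<omega>))\<^sup>2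
        = (1 / real n)\<^sup>2 * (X \<omega> - expectation X)\<^sup>2" for \<omega>
      by (simp only: integral_mult_right_zero power_mult_distrib[symmetric] right_diff_distrib)
    then show ?thesis by (simp only: integral_mult_right_zero)
  qed
  ultimately show "variance (\<lambda>\<omega>. 1 / real n * (\<Sum>i<n. f (D i \<omega>)))
      = 1 / real n * (\<integral>z. (f z - (\<integral>z. f z \<partial>P))\<^sup>2 \<partial>P)"
    using n by (simp only:) (simp add: power2_eq_square field_simps)
qed

text \<open>The residual \<open>Z - C\<close> is orthogonal to \<open>C\<close>, because
  \<open>C\<close> is \<open>F\<close>-measurable, and \<open>C\<close> has the same mean as
  \<open>Z\<close>. The expected squared deviation on the right is also the expectation of the
  conditional variance.\<close>

lemma total_variance:
  fixes Z :: "'a \<Rightarrow> real"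
  assumes "prob_space M" "subalgebra M F"
    and [measurable]: "Z \<in> borel_measurable M" and sq: "integrable M (\<lambda>\<omega>. (Z \<omega>)\<^sup>2)"
  defines "C \<equiv> real_cond_exp M F Z"
  shows "integrable M (\<lambda>\<omega>. (C \<omega>)\<^sup>2)"
    and "integrable M (\<lambda>\<omega>. (Z \<omega> - C \<omega>)\<^sup>2)"
    and "(\<integral>\<omega>. (Z \<omega> - (\<integral>\<omega>. Z \<omega> \<partial>M))\<^sup>2 \<partial>M)
      = (\<integral>\<omega>. (Z \<omega> - C \<omega>)\<^sup>2 \<partial>M) + (\<integral>\<omega>. (C \<omega> - (\<integral>\<omega>. C \<omega> \<partial>M))\<^sup>2 \<partial>M)"
proof -
  interpret prob_space M by fact
  interpret finite_measure_subalgebra M F by standard fact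
  have [measurable]: "C \<in> borel_measurable F" "C \<in> borel_measurable M"
    unfolding C_def by auto
  have Z: "integrable M Z" using sq by (auto intro: square_integrable_imp_integrable)
  \<comment> \<open>Conditional Jensen inequality for the square.\<close>
  show C2: "integrable M (\<lambda>\<omega>. (C \<omega>)\<^sup>2)"
    unfolding C_def using Z sq
    by (intro integrable_convex_cond_exp[of Z UNIV]) (auto intro: convex_power2)
  have "integrable M (\<lambda>\<omega>. C \<omega> * Z \<omega>)"
    using C2 sq by (intro integrable_times_of_squares) auto
  \<comment> \<open>Against the \<open>F\<close>-measurable factor \<open>C\<close>,
    \<open>Z\<close> may be replaced by its conditional expectation, which turns
    \<open>E[C Z]\<close> into \<open>E[C\<^sup>2]\<close>.\<close>
  from this real_cond_exp_intg(2)[OF this]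
  have CZ: "integrable M (\<lambda>\<omega>. C \<omega> * Z \<omega>)"
    "expectation (\<lambda>\<omega>. C \<omega> * Z \<omega>) = expectation (\<lambda>\<omega>. (C \<omega>)\<^sup>2)"
    by (simp_all add: C_def power2_eq_square)
  have C: "integrable M C" "expectation C = expectation Z"
    unfolding C_def using real_cond_exp_int[OF Z] by auto
  have expand: "(Z \<omega> - C \<omega>)\<^sup>2 = (Z \<omega>)\<^sup>2 + (C \<omega>)\<^sup>2 - 2 * (C \<omega> * Z \<omega>)" for \<omega>
    by (simp add: power2_diff)
  show "integrable M (\<lambda>\<omega>. (Z \<omega> - C \<omega>)\<^sup>2)"
    unfolding expand using sq C2 CZ by simp
  show "variance Z = expectation (\<lambda>\<omega>. (Z \<omega> - C \<omega>)\<^sup>2) + variance C"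
    unfolding expand using sq C2 CZ variance_eq[OF Z sq] variance_eq[OF C(1) C2] C(2) by simp
qed

text \<open>The simplifier would otherwise turn the action set \<open>{0, 1}\<close> into \<open>{0, Suc 0}\<close>, on which facts
  about \<^term>\<open>actions\<close> no longer match.\<close>

declare One_nat_def [simp del]

section \<open>Generated sigma-algebras and integration over the two actions\<close>

lemma subalgebra_vimage_algebra:
  assumes "sets M = sets R" "f \<in> measurable R N"
  shows "subalgebra M (vimage_algebra (space R) f N)"
proof -
  have "space M = space R" using assms(1) by (rule sets_eq_imp_space_eq)
  moreover have "f \<in> space R \<rightarrow> space N" using assms(2) by (rule measurable_space[THEN Pi_I])
  ultimately show ?thesis
    using assms by (auto simp: subalgebra_def sets_vimage_algebra2 intro: measurable_sets)
qed

text \<open>Fubini with counting measure, in both orders: the first form serves integration at a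
  fixed covariate, the second keeps the outcome as the outer variable.\<close>

lemma integral_actions_pair:
  fixes f :: "nat \<times> real \<Rightarrow> real"
  assumes "sigma_finite_measure M" and f: "integrable (actions \<Otimes>\<^sub>M M) f"
  shows "(\<integral>z. f z \<partial>(actions \<Otimes>\<^sub>M M)) = (\<Sum>a\<in>{0, 1}. \<integral>y. f (a, y) \<partial>M)"
    and "(\<integral>z. f z \<partial>(actions \<Otimes>\<^sub>M M)) = (\<integral>y. (\<Sum>a\<in>{0, 1}. f (a, y)) \<partial>M)"
proof -
  interpret M: sigma_finite_measure M by fact
  interpret actions: sigma_finite_measure actions by (rule sigma_finite_measure_count_space_finite) simp
  interpret pair_sigma_finite actions M ..
  show "(\<integral>z. f z \<partial>(actions \<Otimes>\<^sub>M M)) = (\<Sum>a\<in>{0, 1}. \<integral>y. f (a, y) \<partial>M)"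
    by (subst integral_fst'[OF f, symmetric]) (simp add: lebesgue_integral_count_space_finite)
  show "(\<integral>z. f z \<partial>(actions \<Otimes>\<^sub>M M)) = (\<integral>y. (\<Sum>a\<in>{0, 1}. f (a, y)) \<partial>M)"
    using integral_snd[of "\<lambda>a y. f (a, y)"] f by (simp add: lebesgue_integral_count_space_finite)
qed

section \<open>Measurability, total mass and iterated integrals in the model\<close>

context bandit_model
begin

abbreviation "R \<equiv> ref_measure MX MY"
abbreviation "P \<equiv> joint_dist MX MY p q \<pi>b"
abbreviation "w \<equiv> w_ATE MX p q \<pi>b"

lemma space_R: "space R = space MX \<times> {0, 1} \<times> space MY"
  by (simp add: space_pair_measure)

lemma sets_P [measurable_cong]: "sets P = sets R"
  unfolding joint_dist_def by (rule sets_density)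

lemma sigma_finite_actions_MY: "sigma_finite_measure (actions \<Otimes>\<^sub>M MY)"
proof -
  interpret actions: sigma_finite_measure actions by (rule sigma_finite_measure_count_space_finite) simp
  interpret pair_sigma_finite actions MY ..
  show ?thesis ..
qed

lemma pair_sigma_finite_R: "pair_sigma_finite MX (actions \<Otimes>\<^sub>M MY)"
  using MX.sigma_finite_measure_axioms sigma_finite_actions_MY by (rule pair_sigma_finite.intro)

lemma measurable_outcome: "(\<lambda>y. y) \<in> borel_measurable MY"
  using sets_MY by (subst measurable_cong_sets[OF sets_MY refl]) (auto intro: measurable_restrict_space1)

text \<open>The outcome comes first because it is the parameter of the integrals over
  \<open>MX\<close>.\<close>

lemma measurable_slice:
  assumes "a \<in> {0, 1}"
  shows "(\<lambda>(y, x). (x, a, y)) \<in> measurable (MY \<Otimes>\<^sub>M MX) R"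
  using assms by (auto simp: split_beta')

lemma measurable_policy: "(\<lambda>(x, a, y). \<pi>b a x) \<in> borel_measurable R"
  using measurable_compose[OF _ \<pi>b_measurable, of "\<lambda>z. (fst (snd z), fst z)" R]
  by (simp add: split_beta')

lemma measurable_rho: "(\<lambda>(x, a, y). rho_ATE \<pi>b a x) \<in> borel_measurable R"
  using measurable_policy unfolding rho_ATE_def by (simp add: split_beta')

lemma measurable_joint_density:
  assumes "(\<lambda>(x, a, y). \<pi> a x) \<in> borel_measurable R"
  shows "joint_density p q \<pi> \<in> borel_measurable R"
proof -
  note assms [measurable] q_measurable [measurable] p_measurable [measurable]
  have "(\<lambda>z. (case z of (x, a, y) \<Rightarrow> q y x a) * (case z of (x, a, y) \<Rightarrow> \<pi> a x) * p (fst z)) \<in> borel_measurable R"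
    by measurable
  then show ?thesis by (simp add: joint_density_def split_beta')
qed

lemma measurable_rho_Y: "rho_Y \<pi>b \<in> borel_measurable R"
  using measurable_rho measurable_outcome unfolding rho_Y_def by (simp add: split_beta')

lemma measurable_outcome_density:
  assumes "(\<lambda>(x, a, y). \<pi> a x) \<in> borel_measurable R"
  shows "outcome_density MX p q \<pi> \<in> borel_measurable MY"
  unfolding outcome_density_def
proof (rule MX.borel_measurable_lebesgue_integral)
  have "(\<lambda>(y, x). joint_density p q \<pi> (x, a, y)) \<in> borel_measurable (MY \<Otimes>\<^sub>M MX)" if "a \<in> {0, 1}" for a
    using measurable_compose[OF measurable_slice[OF that] measurable_joint_density[OF assms]]
    by (simp add: split_beta')
  then show "(\<lambda>(y, x). \<Sum>a\<in>{0, 1}. joint_density p q \<pi> (x, a, y)) \<in> borel_measurable (MY \<Otimes>\<^sub>M MX)"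
    by (simp add: split_beta')
qed

lemma measurable_w: "w \<in> borel_measurable MY"
proof -
  have "outcome_density MX p q (det_policy a) \<in> borel_measurable MY" for a
    by (rule measurable_outcome_density) (auto simp: det_policy_def split_beta')
  moreover have "outcome_density MX p q \<pi>b \<in> borel_measurable MY"
    by (rule measurable_outcome_density[OF measurable_policy])
  ultimately show ?thesis unfolding w_ATE_def by measurable
qed

lemma joint_density_nonneg: "z \<in> space R \<Longrightarrow> 0 \<le> joint_density p q \<pi>b z"
  using p_nonneg q_nonneg \<pi>b_support
  by (auto simp: space_R joint_density_def less_imp_le)

text \<open>Integrating out the outcome, then the action, then the covariates uses the three
  normalisations in turn.\<close>

lemma prob_space_P: "prob_space P"
proof
  interpret AY: sigma_finite_measure "actions \<Otimes>\<^sub>M MY" by (rule sigma_finite_actions_MY)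
  note measurable_joint_density[OF measurable_policy, measurable]
  have inner: "(\<integral>\<^sup>+z. ennreal (joint_density p q \<pi>b (x, z)) \<partial>(actions \<Otimes>\<^sub>M MY)) = ennreal (p x)"
    if x: "x \<in> space MX" for x
  proof -
    have "(\<integral>\<^sup>+z. ennreal (joint_density p q \<pi>b (x, z)) \<partial>(actions \<Otimes>\<^sub>M MY))
        = (\<Sum>a\<in>{0, 1}. \<integral>\<^sup>+y. ennreal (joint_density p q \<pi>b (x, a, y)) \<partial>MY)"
      using x by (subst MY.nn_integral_fst[symmetric]) (auto simp: nn_integral_count_space_finite)
    also have "\<dots> = (\<Sum>a\<in>{0, 1}. ennreal (\<pi>b a x * p x))"
    proof (rule sum.cong[OF refl])
      fix a :: nat assume a: "a \<in> {0, 1}"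
      have q: "(\<lambda>y. q y x a) \<in> borel_measurable MY"
        using measurable_compose[OF _ q_measurable, of "\<lambda>y. (x, a, y)" MY] x a by simp
      have "(\<integral>\<^sup>+y. ennreal (joint_density p q \<pi>b (x, a, y)) \<partial>MY)
          = (\<integral>\<^sup>+y. ennreal (\<pi>b a x * p x) * ennreal (q y x a) \<partial>MY)"
        using x a p_nonneg q_nonneg \<pi>b_support
        by (intro nn_integral_cong) (simp add: joint_density_def ennreal_mult'' less_imp_le mult_ac)
      also have "\<dots> = ennreal (\<pi>b a x * p x)"
        using q q_normalized[OF x a] by (subst nn_integral_cmult) auto
      finally show "(\<integral>\<^sup>+y. ennreal (joint_density p q \<pi>b (x, a, y)) \<partial>MY) = ennreal (\<pi>b a x * p x)" .
    qed
    also have "\<dots> = ennreal (\<Sum>a\<in>{0, 1}. \<pi>b a x * p x)"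
      using x p_nonneg \<pi>b_support by (intro sum_ennreal) (auto simp: less_imp_le)
    also have "(\<Sum>a\<in>{0, 1}. \<pi>b a x * p x) = p x"
      using \<pi>b_normalized[OF x] by (simp only: sum_distrib_right[symmetric] mult_1)
    finally show ?thesis .
  qed
  have "emeasure P (space P) = (\<integral>\<^sup>+z. ennreal (joint_density p q \<pi>b z) \<partial>R)"
    unfolding joint_dist_def by (subst emeasure_density) (auto intro!: nn_integral_cong)
  also have "\<dots> = (\<integral>\<^sup>+x. ennreal (p x) \<partial>MX)"
    by (subst AY.nn_integral_fst[symmetric]) (auto intro!: nn_integral_cong inner)
  finally show "emeasure P (space P) = 1" using p_normalized by simp
qed

lemma integral_P:
  assumes "f \<in> borel_measurable R"
  shows "(\<integral>z. f z \<partial>P) = (\<integral>z. joint_density p q \<pi>b z * f z \<partial>R)"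
    and "integrable P f \<longleftrightarrow> integrable R (\<lambda>z. joint_density p q \<pi>b z * f z)"
proof -
  have "AE z in R. 0 \<le> joint_density p q \<pi>b z" by (intro AE_I2 joint_density_nonneg)
  with assms show "(\<integral>z. f z \<partial>P) = (\<integral>z. joint_density p q \<pi>b z * f z \<partial>R)"
    unfolding joint_dist_def
    by (intro integral_real_density measurable_joint_density measurable_policy)
  from \<open>AE z in R. 0 \<le> joint_density p q \<pi>b z\<close> assms
  show "integrable P f \<longleftrightarrow> integrable R (\<lambda>z. joint_density p q \<pi>b z * f z)"
    unfolding joint_dist_def
    by (intro integrable_real_density measurable_joint_density measurable_policy)
qed

lemma integrable_joint_density: "integrable R (joint_density p q \<pi>b)"
proof -
  interpret prob_space P by (rule prob_space_P)
  show ?thesis using integral_P(2)[of "\<lambda>_. 1"] by simp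
qed

text \<open>Fubini with the outcome outermost, the order suited to conditioning on
  \<open>Y\<close>.\<close>

lemma integral_R_snd:
  fixes f :: "'x \<times> nat \<times> real \<Rightarrow> real"
  assumes "integrable R f"
  shows "(\<integral>z. f z \<partial>R) = (\<integral>y. (\<Sum>a\<in>{0, 1}. \<integral>x. f (x, a, y) \<partial>MX) \<partial>MY)"
proof -
  interpret pair_sigma_finite MX "actions \<Otimes>\<^sub>M MY" by (rule pair_sigma_finite_R)
  have "(\<integral>z. f z \<partial>R) = (\<integral>ay. (\<integral>x. f (x, ay) \<partial>MX) \<partial>(actions \<Otimes>\<^sub>M MY))"
    using integral_snd[of "\<lambda>x ay. f (x, ay)"] assms by simp
  also have "\<dots> = (\<integral>y. (\<Sum>a\<in>{0, 1}. \<integral>x. f (x, a, y) \<partial>MX) \<partial>MY)"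
    using integrable_snd[of "\<lambda>x ay. f (x, ay)"] assms
    by (intro integral_actions_pair(2) MY.sigma_finite_measure_axioms) simp
  finally show ?thesis .
qed

lemma measurable_sum_integral_MX:
  fixes f :: "'x \<times> nat \<times> real \<Rightarrow> real"
  assumes "f \<in> borel_measurable R"
  shows "(\<lambda>y. \<Sum>a\<in>{0, 1}. \<integral>x. f (x, a, y) \<partial>MX) \<in> borel_measurable MY"
proof (rule borel_measurable_sum)
  fix a :: nat assume "a \<in> {0, 1}"
  from measurable_compose[OF measurable_slice[OF this] assms]
  show "(\<lambda>y. \<integral>x. f (x, a, y) \<partial>MX) \<in> borel_measurable MY"
    by (intro MX.borel_measurable_lebesgue_integral) (simp add: split_beta')
qed

text \<open>The Bochner integral of a non-integrable function is 0 by default, so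
  \<open>outcome_density\<close> is split over the actions only at those \<open>y\<close> where both
  slices are integrable. By Fubini this is almost every \<open>y\<close>.\<close>

lemma AE_integrable_joint_density:
  "AE y in MY. \<forall>a\<in>{0, 1}. integrable MX (\<lambda>x. joint_density p q \<pi>b (x, a, y))"
proof -
  interpret R: pair_sigma_finite MX "actions \<Otimes>\<^sub>M MY" by (rule pair_sigma_finite_R)
  interpret actions: sigma_finite_measure actions by (rule sigma_finite_measure_count_space_finite) simp
  interpret pair_sigma_finite actions MY ..
  have "AE ay in actions \<Otimes>\<^sub>M MY. integrable MX (\<lambda>x. joint_density p q \<pi>b (x, ay))"
    using R.AE_integrable_snd[of "\<lambda>x ay. joint_density p q \<pi>b (x, ay)"] integrable_joint_density by simp
  \<comment> \<open>Counting measure has no nonempty null set, so the property holds for each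
    action.\<close>
  from AE_pair[OF this] show ?thesis
    by (simp add: AE_count_space)
qed

lemma outcome_density_det_policy:
  assumes "a \<in> {0, 1}"
  shows "outcome_density MX p q (det_policy a) y = (\<integral>x. q y x a * p x \<partial>MX)"
  using assms by (auto simp: outcome_density_def joint_density_def det_policy_def)

text \<open>Where \<open>p\<^bsub>\<pi>b\<^esub>(y) = 0\<close>, the quotient \<open>w\<close> is the junk value \<open>0\<close>, but there the support
  condition makes the numerator vanish as well.\<close>
lemma AE_w_mult_outcome_density:
  "AE y in MY. w y * (\<Sum>a\<in>{0, 1}. \<integral>x. joint_density p q \<pi>b (x, a, y) \<partial>MX)
    = outcome_density MX p q (det_policy 1) y - outcome_density MX p q (det_policy 0) y"
  using AE_integrable_joint_density
proof (rule AE_mp, intro AE_I2 impI)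
  fix y assume y: "y \<in> space MY"
    and int: "\<forall>a\<in>{0, 1}. integrable MX (\<lambda>x. joint_density p q \<pi>b (x, a, y))"
  have eq: "outcome_density MX p q \<pi>b y = (\<Sum>a\<in>{0, 1}. \<integral>x. joint_density p q \<pi>b (x, a, y) \<partial>MX)"
    unfolding outcome_density_def using int by (intro Bochner_Integration.integral_sum) auto
  show "w y * (\<Sum>a\<in>{0, 1}. \<integral>x. joint_density p q \<pi>b (x, a, y) \<partial>MX)
    = outcome_density MX p q (det_policy 1) y - outcome_density MX p q (det_policy 0) y"
  proof (cases "outcome_density MX p q \<pi>b y = 0")
    case False
    then show ?thesis by (simp add: eq[symmetric] w_ATE_def del: sum.insert)
  next
    case True
    have nonneg: "0 \<le> joint_density p q \<pi>b (x, a, y)" if "x \<in> space MX" "a \<in> {0, 1}" for x a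
      using that y by (intro joint_density_nonneg) (simp add: space_R)
    have "outcome_density MX p q (det_policy a) y = 0" if a: "a \<in> {0, 1}" for a
    proof -
      \<comment> \<open>Nonnegative integrals summing to zero vanish one by one, and then so does
        each nonnegative integrand almost everywhere.\<close>
      have "(\<integral>x. joint_density p q \<pi>b (x, b, y) \<partial>MX) \<ge> 0" if "b \<in> {0, 1}" for b
        using nonneg that by (intro integral_nonneg_AE) auto
      then have "(\<integral>x. joint_density p q \<pi>b (x, a, y) \<partial>MX) = 0"
        using True a unfolding eq by (subst (asm) sum_nonneg_eq_0_iff) auto
      then have "AE x in MX. joint_density p q \<pi>b (x, a, y) = 0"
        using int a nonneg by (subst (asm) integral_nonneg_eq_0_iff_AE) auto
      \<comment> \<open>The positive factor \<open>\<pi>b a x\<close> is cancelled from the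
        vanishing density.\<close>
      then have "AE x in MX. q y x a * p x = 0"
      proof (rule AE_mp, intro AE_I2 impI)
        fix x assume "x \<in> space MX" "joint_density p q \<pi>b (x, a, y) = 0"
        then show "q y x a * p x = 0"
          using \<pi>b_support[of x a] a by (auto simp: joint_density_def)
      qed
      then show ?thesis
        by (simp add: outcome_density_det_policy[OF a] integral_eq_zero_AE)
    qed
    then show ?thesis using True by (simp add: w_ATE_def)
  qed
qed

section \<open>Conditional expectations given \<open>X\<close>, \<open>(X, A)\<close> and
  \<open>Y\<close>\<close>

lemma subalgebra_sigma_X: "subalgebra P (sigma_X MX MY)"
  unfolding sigma_X_def by (rule subalgebra_vimage_algebra[OF sets_P]) (simp add: split_beta')

lemma subalgebra_sigma_XA: "subalgebra P (sigma_XA MX MY)"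
  unfolding sigma_XA_def by (rule subalgebra_vimage_algebra[OF sets_P]) (simp add: split_beta')

lemma subalgebra_sigma_Y: "subalgebra P (sigma_Y MX MY)"
  unfolding sigma_Y_def by (rule subalgebra_vimage_algebra[OF sets_P]) (simp add: split_beta')

lemma measurable_sigma_XA:
  assumes "(\<lambda>(a, x). h a x) \<in> borel_measurable (actions \<Otimes>\<^sub>M MX)"
  shows "(\<lambda>(x, a, y). h a x) \<in> borel_measurable (sigma_XA MX MY)"
proof -
  have "(\<lambda>(x, a, y). (x, a)) \<in> measurable (sigma_XA MX MY) (MX \<Otimes>\<^sub>M actions)"
    unfolding sigma_XA_def by (rule measurable_vimage_algebra1) (auto simp: space_pair_measure)
  \<comment> \<open>A swap: policies take the action first, the generator of \<open>sigma_XA\<close>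
    lists it second.\<close>
  moreover have "(\<lambda>(x, a). h a x) \<in> borel_measurable (MX \<Otimes>\<^sub>M actions)"
    using measurable_compose[OF measurable_pair_swap' assms] by (simp add: split_beta')
  ultimately show ?thesis
    by (rule measurable_compose[THEN measurable_cong[THEN iffD1, rotated]]) auto
qed

lemma measurable_sigma_Y:
  assumes "h \<in> borel_measurable MY"
  shows "(\<lambda>(x, a, y). h y) \<in> borel_measurable (sigma_Y MX MY)"
proof -
  have "(\<lambda>(x, a, y). y) \<in> measurable (sigma_Y MX MY) MY"
    unfolding sigma_Y_def by (rule measurable_vimage_algebra1) (auto simp: space_pair_measure)
  from measurable_compose[OF this assms] show ?thesis
    by (simp add: split_beta')
qed

text \<open>The weight is a function of \<open>(X, A)\<close>, so it can be pulled out of the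
  conditional expectation.\<close>

lemma real_cond_exp_XA_rho_Y:
  assumes "integrable P (rho_Y \<pi>b)"
  shows "AE z in P. real_cond_exp P (sigma_XA MX MY) (rho_Y \<pi>b) z = rho_mu MX MY P \<pi>b z"
proof -
  interpret prob_space P by (rule prob_space_P)
  interpret finite_measure_subalgebra P "sigma_XA MX MY"
    by standard (rule subalgebra_sigma_XA)
  have rho: "(\<lambda>(x, a, y). rho_ATE \<pi>b a x) \<in> borel_measurable (sigma_XA MX MY)"
    using \<pi>b_measurable by (intro measurable_sigma_XA) (simp add: rho_ATE_def split_beta')
  have Y: "(\<lambda>(x, a, y). y) \<in> borel_measurable P"
    using measurable_outcome by (simp add: split_beta')
  have eq: "rho_Y \<pi>b = (\<lambda>z. (case z of (x, a, y) \<Rightarrow> rho_ATE \<pi>b a x) * (case z of (x, a, y) \<Rightarrow> y))"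
    by (auto simp: rho_Y_def)
  show ?thesis
    using real_cond_exp_mult[OF rho Y] assms by (simp add: eq rho_mu_def mu_XA_def split_beta')
qed

text \<open>Tested on the events \<open>Y \<in> B\<close>. Multiplying the density by the weight
  cancels the policy, so at fixed \<open>y\<close> the integral over covariates and actions gives
  \<open>y\<close> times the difference of the two target outcome densities, which is
  \<open>w y * y\<close> times the behaviour outcome density.\<close>

lemma real_cond_exp_Y_rho_Y:
  assumes int_rho_Y: "integrable P (rho_Y \<pi>b)" and int_wY: "integrable P (\<lambda>(x, a, y). w y * y)"
  shows "AE z in P. real_cond_exp P (sigma_Y MX MY) (rho_Y \<pi>b) z = (case z of (x, a, y) \<Rightarrow> w y * y)"
proof -
  interpret prob_space P by (rule prob_space_P)
  interpret finite_measure_subalgebra P "sigma_Y MX MY"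
    by standard (rule subalgebra_sigma_Y)
  note measurable_w [measurable] measurable_outcome [measurable] measurable_rho_Y [measurable]
    measurable_joint_density[OF measurable_policy, measurable]
  show ?thesis
  proof (rule real_cond_exp_charact)
    fix A assume "A \<in> sets (sigma_Y MX MY)"
    then obtain B where B [measurable]: "B \<in> sets MY" and A: "A = (\<lambda>(x, a, y). y) -` B \<inter> space R"
      unfolding sigma_Y_def by (subst (asm) sets_vimage_algebra2) (auto simp: space_R)
    have A_sets [measurable]: "A \<in> sets R"
      unfolding A by (rule measurable_sets[OF _ B]) (simp add: split_beta')
    have int: "integrable R (\<lambda>z. joint_density p q \<pi>b z * (indicator A z * f z))"
      if "integrable P f" "f \<in> borel_measurable R" for f
      using integrable_mult_indicator[of A P f] that sets_P A_sets by (simp add: integral_P(2))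
    have set_integral: "(\<integral>z\<in>A. f z \<partial>P)
        = (\<integral>y. (\<Sum>a\<in>{0, 1}. \<integral>x. joint_density p q \<pi>b (x, a, y) * (indicator A (x, a, y) * f (x, a, y)) \<partial>MX) \<partial>MY)"
      if "integrable P f" "f \<in> borel_measurable R" for f
      using that int[OF that] unfolding set_lebesgue_integral_def
      by (simp add: integral_P(1) integral_R_snd del: sum.insert)
    \<comment> \<open>Events of \<open>sigma_Y\<close> constrain the outcome alone, so the indicator
      is constant in the inner integrals.\<close>
    have A_iff: "indicator A (x, a, y) = (indicator B y :: real)"
      if "x \<in> space MX" "a \<in> {0, 1}" "y \<in> space MY" for x a y
      using that by (auto simp: A space_R indicator_def)
    define wY where "wY = (\<lambda>z :: 'x \<times> nat \<times> real. case z of (x, a, y) \<Rightarrow> w y * y)"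
    have wY: "integrable P wY" "wY \<in> borel_measurable R"
      using int_wY unfolding wY_def by (auto simp: split_beta')
    have "AE y in MY.
        (\<Sum>a\<in>{0, 1}. \<integral>x. joint_density p q \<pi>b (x, a, y) * (indicator A (x, a, y) * rho_Y \<pi>b (x, a, y)) \<partial>MX)
      = (\<Sum>a\<in>{0, 1}. \<integral>x. joint_density p q \<pi>b (x, a, y) * (indicator A (x, a, y) * wY (x, a, y)) \<partial>MX)"
      using AE_w_mult_outcome_density
    proof (rule AE_mp, intro AE_I2 impI)
      fix y assume y: "y \<in> space MY"
        and w: "w y * (\<Sum>a\<in>{0, 1}. \<integral>x. joint_density p q \<pi>b (x, a, y) \<partial>MX)
          = outcome_density MX p q (det_policy 1) y - outcome_density MX p q (det_policy 0) y"
      have rho: "(\<integral>x. joint_density p q \<pi>b (x, a, y) * (indicator A (x, a, y) * rho_Y \<pi>b (x, a, y)) \<partial>MX)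
          = (of_bool (a = 1) - of_bool (a = 0)) * (indicator B y * y) * outcome_density MX p q (det_policy a) y"
        if a: "a \<in> {0, 1}" for a
      proof -
        have "joint_density p q \<pi>b (x, a, y) * (indicator A (x, a, y) * rho_Y \<pi>b (x, a, y))
            = (of_bool (a = 1) - of_bool (a = 0)) * (indicator B y * y) * (q y x a * p x)"
          if x: "x \<in> space MX" for x
          using \<pi>b_support[OF x a] A_iff[OF x a y] by (simp add: joint_density_def rho_Y_def rho_ATE_def)
        then show ?thesis
          unfolding outcome_density_det_policy[OF a] integral_mult_right_zero[symmetric]
          by (rule Bochner_Integration.integral_cong[OF refl])
      qed
      have wY: "(\<integral>x. joint_density p q \<pi>b (x, a, y) * (indicator A (x, a, y) * wY (x, a, y)) \<partial>MX)
          = indicator B y * y * (w y * (\<integral>x. joint_density p q \<pi>b (x, a, y) \<partial>MX))"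
        if a: "a \<in> {0, 1}" for a
        unfolding integral_mult_right_zero[symmetric] using A_iff[OF _ a y]
        by (intro Bochner_Integration.integral_cong[OF refl]) (simp add: wY_def)
      have "(\<Sum>a\<in>{0, 1}. \<integral>x. joint_density p q \<pi>b (x, a, y) * (indicator A (x, a, y) * rho_Y \<pi>b (x, a, y)) \<partial>MX)
          = indicator B y * y * (outcome_density MX p q (det_policy 1) y - outcome_density MX p q (det_policy 0) y)"
        by (simp add: rho right_diff_distrib)
      also have "\<dots> = indicator B y * y * (w y * (\<Sum>a\<in>{0, 1}. \<integral>x. joint_density p q \<pi>b (x, a, y) \<partial>MX))"
        by (simp only: w)
      also have "\<dots> = (\<Sum>a\<in>{0, 1}. \<integral>x. joint_density p q \<pi>b (x, a, y) * (indicator A (x, a, y) * wY (x, a, y)) \<partial>MX)"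
        by (simp add: wY distrib_left)
      finally show "(\<Sum>a\<in>{0, 1}. \<integral>x. joint_density p q \<pi>b (x, a, y) * (indicator A (x, a, y) * rho_Y \<pi>b (x, a, y)) \<partial>MX)
          = (\<Sum>a\<in>{0, 1}. \<integral>x. joint_density p q \<pi>b (x, a, y) * (indicator A (x, a, y) * wY (x, a, y)) \<partial>MX)" .
    qed
    then have "(\<integral>z\<in>A. rho_Y \<pi>b z \<partial>P) = (\<integral>z\<in>A. wY z \<partial>P)"
      unfolding set_integral[OF int_rho_Y measurable_rho_Y] set_integral[OF wY]
      using wY(2) by (intro integral_cong_AE measurable_sum_integral_MX borel_measurable_times
        borel_measurable_indicator A_sets measurable_rho_Y measurable_joint_density measurable_policy)
    then show "(\<integral>z\<in>A. rho_Y \<pi>b z \<partial>P) = (\<integral>z\<in>A. (case z of (x, a, y) \<Rightarrow> w y * y) \<partial>P)"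
      by (simp only: wY_def)
  next
    show "(\<lambda>(x, a, y). w y * y) \<in> borel_measurable (sigma_Y MX MY)"
      by (rule measurable_sigma_Y) measurable
  qed (use assms in auto)
qed

text \<open>Given \<open>X = x\<close>, action \<open>a\<close> contributes its probability times
  the weight, that is \<open>1\<close> or \<open>-1\<close>, times \<open>m x\<close>; the two
  contributions cancel.\<close>

lemma real_cond_exp_X_rho_mult:
  assumes m: "m \<in> borel_measurable MX" and int_m: "integrable P (\<lambda>(x, a, y). rho_ATE \<pi>b a x * m x)"
  shows "AE z in P. real_cond_exp P (sigma_X MX MY) (\<lambda>(x, a, y). rho_ATE \<pi>b a x * m x) z = 0"
proof -
  interpret prob_space P by (rule prob_space_P)
  interpret finite_measure_subalgebra P "sigma_X MX MY"
    by standard (rule subalgebra_sigma_X)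
  interpret R: pair_sigma_finite MX "actions \<Otimes>\<^sub>M MY" by (rule pair_sigma_finite_R)
  note m [measurable]
  define f where "f = (\<lambda>z :: 'x \<times> nat \<times> real. case z of (x, a, y) \<Rightarrow> rho_ATE \<pi>b a x * m x)"
  have f [measurable]: "f \<in> borel_measurable R"
    using measurable_rho unfolding f_def by (simp add: split_beta')
  have f_int: "integrable P f" using int_m by (simp add: f_def)
  have "AE z in P. real_cond_exp P (sigma_X MX MY) f z = 0"
  proof (rule real_cond_exp_charact)
    fix A assume "A \<in> sets (sigma_X MX MY)"
    then obtain B where B [measurable]: "B \<in> sets MX" and A: "A = (\<lambda>(x, a, y). x) -` B \<inter> space R"
      unfolding sigma_X_def by (subst (asm) sets_vimage_algebra2) (auto simp: space_R)
    have A_sets [measurable]: "A \<in> sets R"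
      unfolding A by (rule measurable_sets[OF _ B]) (simp add: split_beta')
    define g where "g = (\<lambda>z. joint_density p q \<pi>b z * (indicator A z * f z))"
    have g: "integrable R g"
      using integrable_mult_indicator[of A P f] f_int sets_P A_sets by (simp add: g_def integral_P(2))
    have "(\<integral>z\<in>A. f z \<partial>P) = (\<integral>z. g z \<partial>R)"
      unfolding set_lebesgue_integral_def g_def by (simp add: integral_P(1))
    also have "\<dots> = (\<integral>x. (\<integral>ay. g (x, ay) \<partial>(actions \<Otimes>\<^sub>M MY)) \<partial>MX)"
      by (rule R.integral_fst'[OF g, symmetric])
    also have "\<dots> = 0"
    \<comment> \<open>Almost every slice of \<open>g\<close> is integrable, and on such slices the
      integral splits over the actions.\<close>
    proof (rule integral_eq_zero_AE, rule AE_mp[OF R.AE_integrable_fst'[OF g]], intro AE_I2 impI)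
      fix x assume x: "x \<in> space MX" and int: "integrable (actions \<Otimes>\<^sub>M MY) (\<lambda>ay. g (x, ay))"
      have "(\<integral>y. g (x, a, y) \<partial>MY)
          = (of_bool (a = 1) - of_bool (a = 0)) * (indicator B x * m x * p x)" if a: "a \<in> {0, 1}" for a
      proof -
        have "g (x, a, y) = (of_bool (a = 1) - of_bool (a = 0)) * (indicator B x * m x * p x) * q y x a"
          if "y \<in> space MY" for y
          using that \<pi>b_support[OF x a] x a
          by (auto simp: g_def f_def A space_R joint_density_def rho_ATE_def indicator_def)
        then have "(\<integral>y. g (x, a, y) \<partial>MY)
            = (of_bool (a = 1) - of_bool (a = 0)) * (indicator B x * m x * p x) * (\<integral>y. q y x a \<partial>MY)"
          unfolding integral_mult_right_zero[symmetric]
          by (rule Bochner_Integration.integral_cong[OF refl])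
        \<comment> \<open>Nonnegativity carries the normalisation from the nonnegative integral over
          to the Bochner integral.\<close>
        also have "(\<integral>y. q y x a \<partial>MY) = 1"
          using q_normalized[OF x a] q_nonneg[OF x a]
            measurable_compose[OF _ q_measurable, of "\<lambda>y. (x, a, y)" MY] x a
          by (subst integral_eq_nn_integral) auto
        finally show ?thesis by simp
      qed
      then show "(\<integral>ay. g (x, ay) \<partial>(actions \<Otimes>\<^sub>M MY)) = 0"
        using integral_actions_pair(1)[OF MY.sigma_finite_measure_axioms int] by simp
    qed
    finally show "(\<integral>z\<in>A. f z \<partial>P) = (\<integral>z\<in>A. 0 \<partial>P)" by simp
  qed (use f_int in auto)
  then show ?thesis by (simp add: f_def)
qed

end

section \<open>Variance comparison of the two estimators\<close>

theorem propositionE2: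
  fixes MX :: "'x measure" and MY :: "real measure"
    and p :: "'x \<Rightarrow> real" and q :: "real \<Rightarrow> 'x \<Rightarrow> nat \<Rightarrow> real"
    and \<pi>b \<mu>hat :: "nat \<Rightarrow> 'x \<Rightarrow> real"
    and \<Omega> :: "'w measure" and D :: "nat \<Rightarrow> 'w \<Rightarrow> 'x \<times> nat \<times> real"
    and n :: nat
  defines "P \<equiv> joint_dist MX MY p q \<pi>b"
    and "DR \<equiv> (\<lambda>\<omega>. ATE_DR \<pi>b \<mu>hat n (\<lambda>i. D i \<omega>))"
    and "MR \<equiv> (\<lambda>\<omega>. ATE_MR (w_ATE MX p q \<pi>b) n (\<lambda>i. D i \<omega>))"
  assumes model: "bandit_model MX MY p q \<pi>b"
    and \<mu>hat: "(\<lambda>(a, x). \<mu>hat a x) \<in> borel_measurable (actions \<Otimes>\<^sub>M MX)"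
    and n: "1 \<le> n"
    and \<Omega>: "prob_space \<Omega>"
    and indep: "prob_space.indep_vars \<Omega> (\<lambda>_. ref_measure MX MY) D {..<n}"
    and ident: "\<And>i. i < n \<Longrightarrow>
      distributed \<Omega> (ref_measure MX MY) (D i) (\<lambda>z. ennreal (joint_density p q \<pi>b z))"
    and Y_integrable: "integrable P (\<lambda>(x, a, y). y)"
    and DR_finite_variance: "integrable \<Omega> (\<lambda>\<omega>. (DR \<omega>)\<^sup>2)"
    and MR_finite_variance: "integrable \<Omega> (\<lambda>\<omega>. (MR \<omega>)\<^sup>2)"
    and rho_Y_cond_var: "has_cond_var P (sigma_Y MX MY) (rho_Y \<pi>b)"
    and rho_mu_cond_var: "has_cond_var P (sigma_X MX MY) (rho_mu MX MY P \<pi>b)"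
  shows "prob_space.variance \<Omega> DR - prob_space.variance \<Omega> MR \<ge>
    1 / real n * prob_space.expectation P
      (\<lambda>z. cond_var P (sigma_Y MX MY) (rho_Y \<pi>b) z
         - cond_var P (sigma_X MX MY) (rho_mu MX MY P \<pi>b) z)"
proof -
  interpret bandit_model MX MY p q \<pi>b by (rule model)
  interpret \<Omega>: prob_space \<Omega> by (rule \<Omega>)
  interpret P: prob_space P unfolding P_def by (rule prob_space_P)
  interpret X: finite_measure_subalgebra P "sigma_X MX MY"
    unfolding P_def by (intro finite_measure_subalgebra.intro finite_measure_subalgebra_axioms.intro
      prob_space.finite_measure prob_space_P subalgebra_sigma_X)
  interpret XA: finite_measure_subalgebra P "sigma_XA MX MY"
    unfolding P_def by (intro finite_measure_subalgebra.intro finite_measure_subalgebra_axioms.intro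
      prob_space.finite_measure prob_space_P subalgebra_sigma_XA)
  interpret Y: finite_measure_subalgebra P "sigma_Y MX MY"
    unfolding P_def by (intro finite_measure_subalgebra.intro finite_measure_subalgebra_axioms.intro
      prob_space.finite_measure prob_space_P subalgebra_sigma_Y)
  have sets_P' [measurable_cong]: "sets P = sets R" unfolding P_def by (rule sets_P)
  have space_P': "space P = space R" using sets_P' by (rule sets_eq_imp_space_eq)
  note measurable_outcome [measurable] measurable_w [measurable] measurable_rho [measurable]
    measurable_rho_Y [measurable]
  \<comment> \<open>The selector \<open>h\<close> covers both the observed action and the constants
    \<open>0\<close> and \<open>1\<close>.\<close>
  have \<mu>hat_R [measurable]: "(\<lambda>z. \<mu>hat (h z) (fst z)) \<in> borel_measurable R"
    if "h \<in> measurable R actions" for h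
    using measurable_compose[OF measurable_Pair[OF that measurable_fst] \<mu>hat] by simp

  define wY where "wY = (\<lambda>(x :: 'x, a :: nat, y). w y * y)"
  \<comment> \<open>The minus sign is absorbed into \<open>m\<close>, so that a DR term becomes the
    sum of \<open>rho_Y \<pi>b\<close> and \<open>g\<close>.\<close>
  define m where "m x = - (\<pi>b 0 x * \<mu>hat 1 x + \<pi>b 1 x * \<mu>hat 0 x)" for x
  define g where "g = (\<lambda>(x, a :: nat, y :: real). rho_ATE \<pi>b a x * m x)"
  define dr where "dr = (\<lambda>(x, a, y). rho_ATE \<pi>b a x * (y - \<mu>hat a x) + (\<mu>hat 1 x - \<mu>hat 0 x))"
  define \<rho>\<mu> where "\<rho>\<mu> = rho_mu MX MY P \<pi>b"
  define V where "V Z = P.expectation (\<lambda>z. (Z z - P.expectation Z)\<^sup>2)" for Z :: "'x \<times> nat \<times> real \<Rightarrow> real"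
  define C where "C F Z = real_cond_exp P F Z" for F and Z :: "'x \<times> nat \<times> real \<Rightarrow> real"

  have m: "m \<in> borel_measurable MX"
  proof -
    have "(\<lambda>x. f a x) \<in> borel_measurable MX"
      if "(\<lambda>(a, x). f a x) \<in> borel_measurable (actions \<Otimes>\<^sub>M MX)" "a \<in> {0, 1}"
      for f :: "nat \<Rightarrow> 'x \<Rightarrow> real" and a
      using measurable_compose[OF _ that(1), of "\<lambda>x. (a, x)" MX] that(2) by simp
    then show ?thesis using \<mu>hat \<pi>b_measurable unfolding m_def by measurable
  qed
  note m [measurable]
  have wY_meas [measurable]: "wY \<in> borel_measurable R"
    unfolding wY_def by (simp add: split_beta')
  have g_meas [measurable]: "g \<in> borel_measurable R"
    using measurable_rho unfolding g_def by (simp add: split_beta')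
  have dr_meas [measurable]: "dr \<in> borel_measurable R"
    using measurable_rho unfolding dr_def by (simp add: split_beta')

  \<comment> \<open>Over the common denominator \<open>\<pi>b a x\<close>, the
    \<open>\<mu>hat\<close>-terms have the numerator \<open>m x\<close> for \<open>a = 1\<close> and
    \<open>- m x\<close> for \<open>a = 0\<close>, by normalisation of the policy; hence the
    restriction to points of the space.\<close>
  have dr_eq: "dr z = rho_Y \<pi>b z + g z" if zP: "z \<in> space P" for z
  proof -
    obtain x a y where z: "z = (x, a, y)" and x: "x \<in> space MX" and a: "a = 0 \<or> a = 1"
      using zP by (cases z) (auto simp: space_P' space_R)
    \<comment> \<open>Normalisation is recorded in both orientations: each case eliminates the
      probability of the action not taken.\<close>
    have \<pi>: "\<pi>b 0 x \<noteq> 0" "\<pi>b 1 x \<noteq> 0" "\<pi>b 0 x = 1 - \<pi>b 1 x" "\<pi>b 1 x = 1 - \<pi>b 0 x"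
      using \<pi>b_support[OF x, of 0] \<pi>b_support[OF x, of 1] \<pi>b_normalized[OF x] by auto
    from a show ?thesis
    proof
      assume "a = 0"
      then show ?thesis
        using \<pi>(1) by (simp add: z dr_def rho_Y_def g_def m_def rho_ATE_def \<pi>(4) field_simps)
    next
      assume "a = 1"
      then show ?thesis
        using \<pi>(2) by (simp add: z dr_def rho_Y_def g_def m_def rho_ATE_def \<pi>(3) field_simps)
    qed
  qed

  \<comment> \<open>Reduction to a single observation\<close>
  have distr: "distr \<Omega> R (D i) = P" if "i < n" for i
    using distributed_distr_eq_density[OF ident[OF that]] by (simp add: P_def joint_dist_def)
  have DR: "DR = (\<lambda>\<omega>. 1 / real n * (\<Sum>i<n. dr (D i \<omega>)))"
    by (simp add: DR_def ATE_DR_def dr_def split_beta' sum.distrib distrib_left add_divide_distrib)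
  have MR: "MR = (\<lambda>\<omega>. 1 / real n * (\<Sum>i<n. wY (D i \<omega>)))"
    by (simp add: MR_def ATE_MR_def wY_def)
  have dr_sq: "integrable P (\<lambda>z. (dr z)\<^sup>2)" and var_DR: "\<Omega>.variance DR = 1 / real n * V dr"
    using \<Omega>.iid_mean_square_integrable_and_variance[OF n indep distr dr_meas] DR_finite_variance
    unfolding DR V_def by auto
  have wY_sq: "integrable P (\<lambda>z. (wY z)\<^sup>2)" and var_MR: "\<Omega>.variance MR = 1 / real n * V wY"
    using \<Omega>.iid_mean_square_integrable_and_variance[OF n indep distr wY_meas] MR_finite_variance
    unfolding MR V_def by auto

  have rho_Y_int: "integrable P (rho_Y \<pi>b)"
    and rho_Y_dev: "integrable P (\<lambda>z. (rho_Y \<pi>b z - C (sigma_Y MX MY) (rho_Y \<pi>b) z)\<^sup>2)"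
    using rho_Y_cond_var by (auto simp: has_cond_var_def C_def)
  have rho_mu_dev: "integrable P (\<lambda>z. (\<rho>\<mu> z - C (sigma_X MX MY) \<rho>\<mu> z)\<^sup>2)"
    using rho_mu_cond_var by (auto simp: has_cond_var_def C_def \<rho>\<mu>_def)
  have C_meas [measurable]: "C F Z \<in> borel_measurable R" if "subalgebra P F" for F Z
    using measurable_from_subalg[OF that borel_measurable_cond_exp] by (simp add: C_def)
  have AE_Y: "AE z in P. C (sigma_Y MX MY) (rho_Y \<pi>b) z = wY z"
    using real_cond_exp_Y_rho_Y[folded P_def] rho_Y_int P.square_integrable_imp_integrable[OF _ wY_sq]
    by (simp add: C_def wY_def)
  have AE_XA: "AE z in P. C (sigma_XA MX MY) (rho_Y \<pi>b) z = \<rho>\<mu> z"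
    using real_cond_exp_XA_rho_Y[folded P_def] rho_Y_int by (simp add: C_def \<rho>\<mu>_def)
  have \<rho>\<mu>_meas [measurable]: "\<rho>\<mu> \<in> borel_measurable R"
    using rho_mu_cond_var by (auto simp: has_cond_var_def \<rho>\<mu>_def)

  \<comment> \<open>Conditional expectations are known only almost everywhere; this lets explicit
    formulas replace them inside variances.\<close>
  have V_cong: "V Z = V Z'" if "AE z in P. Z z = Z' z" "Z \<in> borel_measurable P" "Z' \<in> borel_measurable P"
    for Z Z'
  proof -
    have "P.expectation Z = P.expectation Z'" using that by (intro integral_cong_AE) auto
    then show ?thesis unfolding V_def using that by (intro integral_cong_AE) auto
  qed

  \<comment> \<open>The assumption bounds only the deviation from \<open>E[\<rho> Y | Y]\<close>.
    That conditional expectation is \<open>wY\<close>, square integrable by the finite variance of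
    MR, and adding it back gives the claim.\<close>
  have rho_Y_sq: "integrable P (\<lambda>z. (rho_Y \<pi>b z)\<^sup>2)"
  proof -
    have "integrable P (\<lambda>z. (rho_Y \<pi>b z - C (sigma_Y MX MY) (rho_Y \<pi>b) z + wY z)\<^sup>2)"
      using rho_Y_dev wY_sq C_meas[OF Y.subalg] by (intro integrable_square_add) auto
    then show ?thesis
      by (rule integrable_cong_AE_imp) (use AE_Y in auto)
  qed
  \<comment> \<open>\<open>g\<close> is controlled as the difference of \<open>dr\<close> and
    \<open>rho_Y \<pi>b\<close>, without any integrability of \<open>\<mu>hat\<close>.\<close>
  have g_sq: "integrable P (\<lambda>z. (g z)\<^sup>2)"
  proof -
    have "integrable P (\<lambda>z. (dr z + - rho_Y \<pi>b z)\<^sup>2)"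
      using dr_sq rho_Y_sq by (intro integrable_square_add) auto
    then show ?thesis
      by (rule Bochner_Integration.integrable_cong[THEN iffD1, rotated -1]) (auto simp: dr_eq)
  qed
  have g_int: "integrable P g" using g_sq by (rule P.square_integrable_imp_integrable[rotated]) measurable
  have \<rho>\<mu>_sq: "integrable P (\<lambda>z. (\<rho>\<mu> z)\<^sup>2)"
    using total_variance(1)[OF P.prob_space_axioms XA.subalg _ rho_Y_sq, folded C_def]
    by (rule integrable_cong_AE_imp) (use AE_XA in auto)
  have \<rho>\<mu>_int: "integrable P \<rho>\<mu>" using \<rho>\<mu>_sq by (rule P.square_integrable_imp_integrable[rotated]) measurable

  \<comment> \<open>Three total variance decompositions follow: of \<open>\<rho> Y\<close> given
    \<open>Y\<close>, of \<open>\<rho> Y\<close> given \<open>(X, A)\<close>, and of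
    \<open>\<rho>\<mu>\<close> given \<open>X\<close>.\<close>
  have V_rho_Y: "V (rho_Y \<pi>b) = P.expectation (\<lambda>z. (rho_Y \<pi>b z - C (sigma_Y MX MY) (rho_Y \<pi>b) z)\<^sup>2) + V wY"
    using total_variance(3)[OF P.prob_space_axioms Y.subalg _ rho_Y_sq] V_cong[OF AE_Y] C_meas[OF Y.subalg]
    by (simp add: V_def C_def)
  have V_rho_Y': "V (rho_Y \<pi>b) = P.expectation (\<lambda>z. (rho_Y \<pi>b z - \<rho>\<mu> z)\<^sup>2) + V \<rho>\<mu>"
  proof -
    have "P.expectation (\<lambda>z. (rho_Y \<pi>b z - C (sigma_XA MX MY) (rho_Y \<pi>b) z)\<^sup>2)
        = P.expectation (\<lambda>z. (rho_Y \<pi>b z - \<rho>\<mu> z)\<^sup>2)"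
      using AE_XA C_meas[OF XA.subalg] by (intro integral_cong_AE) auto
    then show ?thesis
      using total_variance(3)[OF P.prob_space_axioms XA.subalg _ rho_Y_sq] V_cong[OF AE_XA] C_meas[OF XA.subalg]
      by (simp add: V_def C_def)
  qed
  have V_\<rho>\<mu>: "V \<rho>\<mu> = P.expectation (\<lambda>z. (\<rho>\<mu> z - C (sigma_X MX MY) \<rho>\<mu> z)\<^sup>2) + V (C (sigma_X MX MY) \<rho>\<mu>)"
    using total_variance(3)[OF P.prob_space_axioms X.subalg _ \<rho>\<mu>_sq] by (simp add: V_def C_def)

  have dr_cond: "AE z in P. C (sigma_XA MX MY) dr z = \<rho>\<mu> z + g z"
  proof -
    \<comment> \<open>\<open>g\<close> depends on \<open>X\<close> and \<open>A\<close> alone, so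
      conditioning on them leaves it unchanged.\<close>
    have "g \<in> borel_measurable (sigma_XA MX MY)"
      unfolding g_def using \<pi>b_measurable by (intro measurable_sigma_XA) (simp add: rho_ATE_def split_beta')
    then have "AE z in P. C (sigma_XA MX MY) g z = g z"
      unfolding C_def using g_int by (intro XA.real_cond_exp_F_meas)
    moreover have "AE z in P. C (sigma_XA MX MY) (\<lambda>z. rho_Y \<pi>b z + g z) z
        = C (sigma_XA MX MY) (rho_Y \<pi>b) z + C (sigma_XA MX MY) g z"
      unfolding C_def using rho_Y_int g_int by (rule XA.real_cond_exp_add)
    moreover have "AE z in P. C (sigma_XA MX MY) dr z = C (sigma_XA MX MY) (\<lambda>z. rho_Y \<pi>b z + g z) z"
      unfolding C_def by (intro XA.real_cond_exp_cong AE_I2 dr_eq) measurable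
    ultimately show ?thesis using AE_XA by eventually_elim simp
  qed
  have V_dr: "V dr = P.expectation (\<lambda>z. (rho_Y \<pi>b z - \<rho>\<mu> z)\<^sup>2) + V (\<lambda>z. \<rho>\<mu> z + g z)"
  proof -
    \<comment> \<open>\<open>g\<close> shifts the DR term and its conditional expectation alike, so
      it drops out of the residual.\<close>
    have "AE z in P. (dr z - C (sigma_XA MX MY) dr z)\<^sup>2 = (rho_Y \<pi>b z - \<rho>\<mu> z)\<^sup>2"
      using dr_cond AE_space by eventually_elim (simp add: dr_eq)
    then have "P.expectation (\<lambda>z. (dr z - C (sigma_XA MX MY) dr z)\<^sup>2)
        = P.expectation (\<lambda>z. (rho_Y \<pi>b z - \<rho>\<mu> z)\<^sup>2)"
      using C_meas[OF XA.subalg] by (intro integral_cong_AE) auto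
    then show ?thesis
      using total_variance(3)[OF P.prob_space_axioms XA.subalg _ dr_sq] V_cong[OF dr_cond] C_meas[OF XA.subalg]
      by (simp add: V_def C_def)
  qed
  \<comment> \<open>Conditioning on \<open>X\<close> removes \<open>g\<close>, and a conditional
    expectation has at most the variance of the variable itself.\<close>
  have "V (C (sigma_X MX MY) \<rho>\<mu>) \<le> V (\<lambda>z. \<rho>\<mu> z + g z)"
  proof -
    have "AE z in P. C (sigma_X MX MY) (\<lambda>z. \<rho>\<mu> z + g z) z = C (sigma_X MX MY) \<rho>\<mu> z + C (sigma_X MX MY) g z"
      unfolding C_def using \<rho>\<mu>_int g_int by (rule X.real_cond_exp_add)
    moreover have "AE z in P. C (sigma_X MX MY) g z = 0"
      using real_cond_exp_X_rho_mult[OF m, folded P_def] g_int by (simp add: C_def g_def)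
    ultimately have "AE z in P. C (sigma_X MX MY) (\<lambda>z. \<rho>\<mu> z + g z) z = C (sigma_X MX MY) \<rho>\<mu> z"
      by eventually_elim simp
    then have "V (C (sigma_X MX MY) (\<lambda>z. \<rho>\<mu> z + g z)) = V (C (sigma_X MX MY) \<rho>\<mu>)"
      using C_meas[OF X.subalg] by (intro V_cong) auto
    moreover have "integrable P (\<lambda>z. (\<rho>\<mu> z + g z)\<^sup>2)"
      using \<rho>\<mu>_sq g_sq by (intro integrable_square_add) auto
    from total_variance(3)[OF P.prob_space_axioms X.subalg _ this]
    have "V (C (sigma_X MX MY) (\<lambda>z. \<rho>\<mu> z + g z)) \<le> V (\<lambda>z. \<rho>\<mu> z + g z)"
      by (simp add: V_def C_def)
    ultimately show ?thesis by simp
  qed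
  \<comment> \<open>The residual given \<open>(X, A)\<close> is shared by \<open>V dr\<close> and
    \<open>V (rho_Y \<pi>b)\<close> and is eliminated between them.\<close>
  then have "P.expectation (\<lambda>z. (rho_Y \<pi>b z - C (sigma_Y MX MY) (rho_Y \<pi>b) z)\<^sup>2)
      - P.expectation (\<lambda>z. (\<rho>\<mu> z - C (sigma_X MX MY) \<rho>\<mu> z)\<^sup>2) \<le> V dr - V wY"
    using V_rho_Y V_rho_Y' V_\<rho>\<mu> V_dr by linarith
  \<comment> \<open>By the tower property each \<open>cond_var\<close> integrates to its expected
    squared deviation; integrability of both deviations allows the difference to be split.\<close>
  moreover have "P.expectation (\<lambda>z. cond_var P (sigma_Y MX MY) (rho_Y \<pi>b) z - cond_var P (sigma_X MX MY) \<rho>\<mu> z)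
      = P.expectation (\<lambda>z. (rho_Y \<pi>b z - C (sigma_Y MX MY) (rho_Y \<pi>b) z)\<^sup>2)
        - P.expectation (\<lambda>z. (\<rho>\<mu> z - C (sigma_X MX MY) \<rho>\<mu> z)\<^sup>2)"
    using Y.real_cond_exp_int[OF rho_Y_dev] X.real_cond_exp_int[OF rho_mu_dev]
    by (simp add: cond_var_def C_def)
  ultimately show ?thesis
    unfolding var_DR var_MR \<rho>\<mu>_def right_diff_distrib[symmetric]
    by (intro mult_left_mono) auto
qed

end
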